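(* Let $G$ be a finite weak almost monomial group and let $N\trianglelefteq G$ be a normal subgroup. Then $G/N$ is weak almost monomial.
   Context: For a finite group $G$, a complex character $\sigma$ of $G$ is monomial if $\sigma=\lambda^G$ for some subgroup $H\le G$ and some linear character $\lambda$ of $H$. $G$ is called weak almost monomial if for any two distinct irreducible complex characters $\chi_i\neq\chi_j$ of $G$ there exists a monomial character $\sigma$ of $G$ with $\langle\chi_i,\sigma\rangle>\langle\chi_j,\sigma\rangle$. *)

theory Defs
  imports
    "HOL-Algebra.Coset"
    "HOL-Library.Complex_Order"
    "Jordan_Normal_Form.VS_Connect"
begin

text \<open>
  A complex matrix representation of degree \<open>n\<close> is a homomorphism into \<open>GL(n, \<complex>)\<close>, the unit group
  of the ring of \<open>n \<times> n\<close> matrices. Characters are taken to be \<open>undefined\<close> outside the carrier, so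
  that equality of characters as HOL functions is equality on the group.
\<close>

definition complex_rep :: "('a, 'b) monoid_scheme \<Rightarrow> nat \<Rightarrow> ('a \<Rightarrow> complex mat) \<Rightarrow> bool" where
  "complex_rep G n \<rho> \<longleftrightarrow> \<rho> \<in> hom G (units_of (ring_mat TYPE(complex) n ()))"

definition rep_character ::
    "('a, 'b) monoid_scheme \<Rightarrow> nat \<Rightarrow> ('a \<Rightarrow> complex mat) \<Rightarrow> 'a \<Rightarrow> complex" where
  "rep_character G n \<rho> = (\<lambda>g\<in>carrier G. \<Sum>i<n. \<rho> g $$ (i, i))"

definition irreducible_rep :: "('a, 'b) monoid_scheme \<Rightarrow> nat \<Rightarrow> ('a \<Rightarrow> complex mat) \<Rightarrow> bool" where
  "irreducible_rep G n \<rho> \<longleftrightarrow>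
     complex_rep G n \<rho> \<and> n > 0 \<and>
     (\<forall>W. VectorSpace.subspace class_ring W (module_vec TYPE(complex) n) \<longrightarrow>
          (\<forall>g\<in>carrier G. \<forall>w\<in>W. \<rho> g *\<^sub>v w \<in> W) \<longrightarrow>
          W = {0\<^sub>v n} \<or> W = carrier_vec n)"

definition complex_character :: "('a, 'b) monoid_scheme \<Rightarrow> ('a \<Rightarrow> complex) \<Rightarrow> bool" where
  "complex_character G \<chi> \<longleftrightarrow> (\<exists>n \<rho>. complex_rep G n \<rho> \<and> \<chi> = rep_character G n \<rho>)"

definition irreducible_character :: "('a, 'b) monoid_scheme \<Rightarrow> ('a \<Rightarrow> complex) \<Rightarrow> bool" where
  "irreducible_character G \<chi> \<longleftrightarrow> (\<exists>n \<rho>. irreducible_rep G n \<rho> \<and> \<chi> = rep_character G n \<rho>)"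

definition linear_character :: "('a, 'b) monoid_scheme \<Rightarrow> ('a \<Rightarrow> complex) \<Rightarrow> bool" where
  "linear_character G \<phi> \<longleftrightarrow> (\<exists>\<rho>. complex_rep G 1 \<rho> \<and> \<phi> = rep_character G 1 \<rho>)"

definition char_inner ::
    "('a, 'b) monoid_scheme \<Rightarrow> ('a \<Rightarrow> complex) \<Rightarrow> ('a \<Rightarrow> complex) \<Rightarrow> complex" where
  "char_inner G \<chi> \<psi> = (\<Sum>g\<in>carrier G. \<chi> g * cnj (\<psi> g)) / of_nat (card (carrier G))"

definition induced_character ::
    "('a, 'b) monoid_scheme \<Rightarrow> 'a set \<Rightarrow> ('a \<Rightarrow> complex) \<Rightarrow> 'a \<Rightarrow> complex" where
  "induced_character G H \<phi> =
     (\<lambda>g\<in>carrier G.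
        (\<Sum>x\<in>{x \<in> carrier G. x \<otimes>\<^bsub>G\<^esub> g \<otimes>\<^bsub>G\<^esub> inv\<^bsub>G\<^esub> x \<in> H}.
            \<phi> (x \<otimes>\<^bsub>G\<^esub> g \<otimes>\<^bsub>G\<^esub> inv\<^bsub>G\<^esub> x)) / of_nat (card H))"

definition monomial_character :: "('a, 'b) monoid_scheme \<Rightarrow> ('a \<Rightarrow> complex) \<Rightarrow> bool" where
  "monomial_character G \<sigma> \<longleftrightarrow>
     complex_character G \<sigma> \<and>
     (\<exists>H \<phi>. subgroup H G \<and> linear_character (G\<lparr>carrier := H\<rparr>) \<phi> \<and>
            \<sigma> = induced_character G H \<phi>)"

text \<open>
  Inner products of characters are nonnegative integers; \<open><\<close> below is the order on \<open>complex\<close> with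
  equal imaginary parts, so it extends the usual order on the reals.
\<close>

definition weak_almost_monomial :: "('a, 'b) monoid_scheme \<Rightarrow> bool" where
  "weak_almost_monomial G \<longleftrightarrow>
     (\<forall>\<chi> \<psi>. irreducible_character G \<chi> \<longrightarrow> irreducible_character G \<psi> \<longrightarrow> \<chi> \<noteq> \<psi> \<longrightarrow>
        (\<exists>\<sigma>. monomial_character G \<sigma> \<and> char_inner G \<chi> \<sigma> > char_inner G \<psi> \<sigma>))"

end

theory Submission
  imports Defs
begin

text \<open>
  Two distinct irreducible characters of \<open>G/N\<close> inflate to distinct irreducible characters of \<open>G\<close>,
  which some induced character \<open>\<sigma> = \<phi>\<^sup>G\<close> separates, with \<open>\<phi>\<close> a linear character of a subgroup \<open>K\<close>.
  Inner products of \<open>\<sigma>\<close> with inflated characters only depend on the sums of \<open>\<sigma>\<close> over the cosets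
  of \<open>N\<close>. If \<open>\<phi>\<close> is nontrivial on \<open>K \<inter> N\<close>, then these sums vanish, so \<open>\<sigma>\<close> separates nothing.
  Otherwise \<open>\<phi>\<close> factors through \<open>KN/N\<close>, and the sums are a positive multiple of the values of the
  character of \<open>G/N\<close> induced from the resulting linear character of \<open>KN/N\<close>.
\<close>

section \<open>Representations, linear characters and inflation\<close>

lemma complex_rep_iff:
  assumes "group G"
  shows "complex_rep G n \<rho> \<longleftrightarrow>
    (\<forall>g\<in>carrier G. \<rho> g \<in> carrier_mat n n) \<and> \<rho> \<one>\<^bsub>G\<^esub> = 1\<^sub>m n \<and>
    (\<forall>g\<in>carrier G. \<forall>h\<in>carrier G. \<rho> (g \<otimes>\<^bsub>G\<^esub> h) = \<rho> g * \<rho> h)" (is "_ \<longleftrightarrow> ?R")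
proof
  interpret G: group G by fact
  interpret M: ring "ring_mat TYPE(complex) n ()" by (rule ring_mat)
  assume "complex_rep G n \<rho>"
  then have hom: "\<rho> \<in> hom G (units_of (ring_mat TYPE(complex) n ()))"
    by (simp add: complex_rep_def)
  have "\<rho> \<one>\<^bsub>G\<^esub> = 1\<^sub>m n"
    using hom_one[OF hom G.is_group M.units_group] by (simp add: units_of_one ring_mat_simps)
  moreover have "\<rho> g \<in> carrier_mat n n" if "g \<in> carrier G" for g
    using hom_in_carrier[OF hom that] M.Units_closed[of "\<rho> g"]
    by (simp add: units_of_carrier ring_mat_simps)
  moreover have "\<rho> (g \<otimes>\<^bsub>G\<^esub> h) = \<rho> g * \<rho> h" if "g \<in> carrier G" "h \<in> carrier G" for g h
    using hom_mult[OF hom that] by (simp add: units_of_mult ring_mat_simps)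
  ultimately show ?R by blast
next
  interpret G: group G by fact
  assume R: ?R
  show "complex_rep G n \<rho>"
    unfolding complex_rep_def
  proof (rule homI)
    fix g assume g: "g \<in> carrier G"
    \<comment> \<open>Invertibility of \<open>\<rho> g\<close> comes for free: multiplicativity
      together with \<open>\<rho> \<one> = 1\<^sub>m n\<close> makes the image of the inverse a
      two-sided inverse.\<close>
    have "\<rho> g * \<rho> (inv\<^bsub>G\<^esub> g) = 1\<^sub>m n" "\<rho> (inv\<^bsub>G\<^esub> g) * \<rho> g = 1\<^sub>m n"
      using R g by (metis G.inv_closed G.r_inv, metis G.inv_closed G.l_inv)
    then show "\<rho> g \<in> carrier (units_of (ring_mat TYPE(complex) n ()))"
      using R g by (auto simp: units_of_carrier Units_def ring_mat_simps)
  qed (use R in \<open>simp add: units_of_mult ring_mat_simps\<close>)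
qed

text \<open>A 1 by 1 matrix is determined by its single entry, and such entries multiply like the
  matrices. Membership in \<open>extensional\<close> reflects that characters are
  \<open>undefined\<close> off the carrier.\<close>

lemma linear_character_iff:
  assumes "group G"
  shows "linear_character G \<phi> \<longleftrightarrow> \<phi> \<in> extensional (carrier G) \<and> \<phi> \<one>\<^bsub>G\<^esub> = 1 \<and>
    (\<forall>g\<in>carrier G. \<forall>h\<in>carrier G. \<phi> (g \<otimes>\<^bsub>G\<^esub> h) = \<phi> g * \<phi> h)" (is "_ \<longleftrightarrow> ?R")
proof
  interpret G: group G by fact
  assume "linear_character G \<phi>"
  then obtain \<rho> where rep: "complex_rep G 1 \<rho>" and \<phi>: "\<phi> = rep_character G 1 \<rho>"
    by (auto simp: linear_character_def)
  have c: "\<rho> g \<in> carrier_mat 1 1" if "g \<in> carrier G" for g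
    using rep that complex_rep_iff[OF assms] by blast
  have "(\<rho> g * \<rho> h) $$ (0, 0) = \<rho> g $$ (0, 0) * \<rho> h $$ (0, 0)"
    if "g \<in> carrier G" "h \<in> carrier G" for g h
    using c[OF that(1)] c[OF that(2)] by (simp add: scalar_prod_def)
  then show ?R
    using rep complex_rep_iff[OF assms] by (simp add: \<phi> rep_character_def)
next
  interpret G: group G by fact
  assume R: ?R
  have "complex_rep G 1 (\<lambda>g. mat 1 1 (\<lambda>_. \<phi> g))"
    using R unfolding complex_rep_iff[OF assms]
    by (auto intro!: eq_matI simp: scalar_prod_def)
  moreover have "\<phi> = rep_character G 1 (\<lambda>g. mat 1 1 (\<lambda>_. \<phi> g))"
    using R by (auto simp: rep_character_def extensional_def fun_eq_iff)
  ultimately show "linear_character G \<phi>"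
    by (auto simp: linear_character_def)
qed

lemma rep_character_comp_hom:
  assumes "f \<in> hom G K"
  shows "rep_character G n (\<rho> \<circ> f) = (\<lambda>g\<in>carrier G. rep_character K n \<rho> (f g))"
  using hom_in_carrier[OF assms] by (auto simp: rep_character_def fun_eq_iff)

text \<open>Since \<open>f\<close> is onto, \<open>\<rho> \<circ> f\<close> and
  \<open>\<rho>\<close> have the same set of matrices as image, hence the same invariant subspaces.
  With \<open>f\<close> the projection to a quotient this is inflation.\<close>

lemma irreducible_character_comp_hom:
  assumes f: "f \<in> hom G K" "f ` carrier G = carrier K"
    and \<chi>: "irreducible_character K \<chi>"
  shows "irreducible_character G (\<lambda>g\<in>carrier G. \<chi> (f g))"
proof -
  obtain n \<rho> where rep: "irreducible_rep K n \<rho>" and \<chi>: "\<chi> = rep_character K n \<rho>"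
    using \<chi> by (auto simp: irreducible_character_def)
  have "complex_rep G n (\<rho> \<circ> f)"
    using rep by (auto simp: irreducible_rep_def complex_rep_def intro: hom_compose[OF f(1)])
  moreover have "(\<forall>g\<in>carrier G. \<forall>w\<in>W. (\<rho> \<circ> f) g *\<^sub>v w \<in> W) \<longleftrightarrow>
      (\<forall>k\<in>carrier K. \<forall>w\<in>W. \<rho> k *\<^sub>v w \<in> W)" for W
    unfolding f(2)[symmetric] by simp
  ultimately have "irreducible_rep G n (\<rho> \<circ> f)"
    using rep unfolding irreducible_rep_def by simp
  then show ?thesis
    unfolding irreducible_character_def \<chi> rep_character_comp_hom[OF f(1), symmetric] by blast
qed

section \<open>Coset sums and the induced representation\<close>

context group
begin

lemma sum_over_rcosets:
  assumes "subgroup H G" "finite (carrier G)"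
  shows "(\<Sum>X\<in>rcosets H. \<Sum>x\<in>X. F x) = (\<Sum>x\<in>carrier G. F x)"
proof -
  have "finite X" if "X \<in> rcosets H" for X
    using subgroup.rcosets_carrier[OF assms(1) is_group that] assms(2) finite_subset by blast
  moreover have "X \<inter> Y = {}" if "X \<in> rcosets H" "Y \<in> rcosets H" "X \<noteq> Y" for X Y
    using rcos_disjoint[OF assms(1)] that by (auto simp: pairwise_def disjnt_def)
  ultimately have "sum F (\<Union>(rcosets H)) = (\<Sum>X\<in>rcosets H. \<Sum>x\<in>X. F x)"
    by (subst sum.Union_disjoint) auto
  then show ?thesis
    using rcosets_part_G[OF assms(1)] by simp
qed

text \<open>\<open>F\<close> is constant on each right coset, and every coset has
  \<open>card H\<close> elements. The choice \<open>t\<close> of representatives is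
  arbitrary.\<close>

lemma sum_rcosets_invariant:
  fixes F :: "'a \<Rightarrow> 'c::comm_semiring_1"
  assumes H: "subgroup H G" "finite (carrier G)"
    and inv: "\<And>h x. \<lbrakk>h \<in> H; x \<in> carrier G\<rbrakk> \<Longrightarrow> F (h \<otimes> x) = F x"
    and t: "\<And>X. X \<in> rcosets H \<Longrightarrow> t X \<in> X"
  shows "of_nat (card H) * (\<Sum>X\<in>rcosets H. F (t X)) = (\<Sum>x\<in>carrier G. F x)"
proof -
  have "(\<Sum>x\<in>X. F x) = of_nat (card H) * F (t X)" if X: "X \<in> rcosets H" for X
  proof -
    have tX: "t X \<in> carrier G"
      using t[OF X] subgroup.rcosets_carrier[OF H(1) is_group X] by blast
    have "X = H #> t X"
      using X t[OF X] repr_independence[OF _ _ H(1)] by (auto simp: RCOSETS_def)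
    then have "\<exists>h\<in>H. x = h \<otimes> t X" if "x \<in> X" for x
      using that unfolding r_coset_def by blast
    then have "F x = F (t X)" if "x \<in> X" for x
      using that inv tX by blast
    then have "(\<Sum>x\<in>X. F x) = of_nat (card X) * F (t X)"
      by (simp cong: sum.cong)
    then show ?thesis
      using card_rcosets_equal[OF X subgroup.subset[OF H(1)]] by simp
  qed
  then show ?thesis
    by (simp add: sum_over_rcosets[OF H, symmetric] sum_distrib_left cong: sum.cong)
qed

lemma sum_carrier_translate:
  assumes "a \<in> carrier G"
  shows "(\<Sum>x\<in>carrier G. F (x \<otimes> a)) = (\<Sum>x\<in>carrier G. F x)"
  by (rule sum.reindex_bij_witness[of _ "\<lambda>x. x \<otimes> inv a" "\<lambda>x. x \<otimes> a"])
     (use assms in \<open>auto simp: m_assoc\<close>)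

text \<open>Extending \<open>\<phi>\<close> by zero makes the index set independent of
  \<open>g\<close>, so that sums can be swapped and reindexed.\<close>

lemma induced_character_extend:
  assumes "finite (carrier G)" "g \<in> carrier G"
  shows "induced_character G H \<phi> g =
    (\<Sum>x\<in>carrier G. if x \<otimes> g \<otimes> inv x \<in> H then \<phi> (x \<otimes> g \<otimes> inv x) else 0) / of_nat (card H)"
  using assms by (simp add: induced_character_def sum.If_cases Int_def)

text \<open>A monomial character has to be shown to be a character. The witness is the induced
  matrix representation on a transversal of the right cosets of \<open>H\<close>; its trace is the
  formula defining \<open>induced_character\<close>.\<close>

lemma complex_character_induced:
  assumes fin: "finite (carrier G)" and H: "subgroup H G"
    and lin: "linear_character (G\<lparr>carrier := H\<rparr>) \<phi>"
  shows "complex_character G (induced_character G H \<phi>)"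
proof -
  have H_G: "h \<in> carrier G" if "h \<in> H" for h
    using that H subgroup.subset by blast
  note H_closed = subgroup.m_closed[OF H] subgroup.m_inv_closed[OF H] subgroup.one_closed[OF H]
  have \<phi>: "\<phi> \<one> = 1" "\<And>h k. \<lbrakk>h \<in> H; k \<in> H\<rbrakk> \<Longrightarrow> \<phi> (h \<otimes> k) = \<phi> h * \<phi> k"
    using lin linear_character_iff[OF subgroup_imp_group[OF H]] by simp_all
  have cardH: "(of_nat (card H) :: complex) \<noteq> 0"
    using H fin H_closed(3) subgroup.finite_imp_card_positive by fastforce
  \<comment> \<open>The extension of \<open>\<phi>\<close> by zero; multiplying its argument by an
    element of \<open>H\<close> on either side still pulls out a factor
    \<open>\<phi> h\<close>.\<close>
  define \<phi>0 where "\<phi>0 x = (if x \<in> H then \<phi> x else 0)" for x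
  have mem_l: "h \<otimes> x \<in> H \<longleftrightarrow> x \<in> H" if "h \<in> H" "x \<in> carrier G" for h x
    using that H_closed H_G by (metis inv_closed inv_solve_left)
  have mem_r: "x \<otimes> h \<in> H \<longleftrightarrow> x \<in> H" if "h \<in> H" "x \<in> carrier G" for h x
    using that H_closed H_G by (metis inv_closed inv_solve_right)
  have \<phi>0_l: "\<phi>0 (h \<otimes> x) = \<phi> h * \<phi>0 x" if "h \<in> H" "x \<in> carrier G" for h x
    using that mem_l \<phi> by (simp add: \<phi>0_def)
  have \<phi>0_r: "\<phi>0 (x \<otimes> h) = \<phi>0 x * \<phi> h" if "h \<in> H" "x \<in> carrier G" for h x
    using that mem_r \<phi> by (simp add: \<phi>0_def)
  have \<phi>_inv: "\<phi> (inv h) * \<phi> h = 1" if "h \<in> H" for h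
    using that \<phi> H_closed H_G by (metis l_inv)
  have fin_cosets: "finite (rcosets H)"
    using fin by (simp add: RCOSETS_def)
  \<comment> \<open>Matrix indices require numbered cosets: \<open>e\<close> enumerates them, and
    \<open>t i\<close> is a representative of the coset \<open>e i\<close>.\<close>
  define n where "n = card (rcosets H)"
  obtain e where e: "bij_betw e {..<n} (rcosets H)"
    using fin_cosets ex_bij_betw_nat_finite[of "rcosets H"]
    by (auto simp: n_def atLeast0LessThan)
  define r where "r X = (SOME x. x \<in> X)" for X :: "'a set"
  have r: "r X \<in> X" if "X \<in> rcosets H" for X
    using subgroup.rcosets_non_empty[OF H that] by (simp add: r_def some_in_eq)
  define t where "t i = r (e i)" for i
  have e_in: "e i \<in> rcosets H" if "i < n" for i
    using e that by (auto simp: bij_betw_def)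
  have t_in: "t i \<in> e i" if "i < n" for i
    using r e_in that by (simp add: t_def)
  have t_G: "t i \<in> carrier G" if "i < n" for i
    using t_in[OF that] subgroup.rcosets_carrier[OF H is_group e_in[OF that]] by blast
  have e_eq: "e i = H #> t i" if "i < n" for i
    using e_in[OF that] t_in[OF that] repr_independence[OF _ _ H] by (auto simp: RCOSETS_def)
  \<comment> \<open>This makes \<open>\<rho> \<one>\<close> the identity matrix: off the diagonal,
    \<open>\<phi>0\<close> is evaluated outside \<open>H\<close>.\<close>
  have same: "t i \<otimes> inv (t j) \<in> H \<longleftrightarrow> i = j" if "i < n" "j < n" for i j
  proof
    assume "t i \<otimes> inv (t j) \<in> H"
    then have "t i \<in> e j"
      using that t_G by (simp add: e_eq r_coset_def)
         (metis inv_closed inv_solve_right m_closed)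
    then have "e i = e j"
      using that e_eq repr_independence[OF _ _ H] t_G by metis
    then show "i = j"
      using e that by (auto simp: bij_betw_def inj_on_def)
  qed (use that t_G H_closed in simp)
  \<comment> \<open>Replacing sums over the transversal by averages over \<open>G\<close> avoids
    tracking how group elements permute the representatives.\<close>
  have sum_t: "(\<Sum>i<n. F (t i)) = (\<Sum>x\<in>carrier G. F x) / of_nat (card H)"
    if "\<And>h x. \<lbrakk>h \<in> H; x \<in> carrier G\<rbrakk> \<Longrightarrow> F (h \<otimes> x) = F x" for F :: "'a \<Rightarrow> complex"
  proof -
    have "(\<Sum>i<n. F (t i)) = (\<Sum>X\<in>rcosets H. F (r X))"
      unfolding t_def by (rule sum.reindex_bij_betw[OF e])
    then show ?thesis
      using sum_rcosets_invariant[OF H fin that r] cardH by (simp add: field_simps)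
  qed
  txt \<open>
    The summand only depends on the coset of \<open>t k\<close>, so the sum is an average over \<open>G\<close>; after
    translation by \<open>a\<close> only the elements of \<open>H\<close> contribute.
  \<close>
  have conv: "(\<Sum>k<n. \<phi>0 (a \<otimes> inv (t k)) * \<phi>0 (t k \<otimes> b)) = \<phi>0 (a \<otimes> b)"
    if a: "a \<in> carrier G" and b: "b \<in> carrier G" for a b
  proof -
    let ?F = "\<lambda>x. \<phi>0 (a \<otimes> inv x) * \<phi>0 (x \<otimes> b)"
    have "?F (h \<otimes> x) = ?F x" if h: "h \<in> H" and x: "x \<in> carrier G" for h x
    proof -
      have "a \<otimes> inv (h \<otimes> x) = (a \<otimes> inv x) \<otimes> inv h" "h \<otimes> x \<otimes> b = h \<otimes> (x \<otimes> b)"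
        using H_G[OF h] x a b by (simp_all add: inv_mult_group m_assoc)
      then have "?F (h \<otimes> x) = ?F x * (\<phi> (inv h) * \<phi> h)"
        using h x a b H_closed by (simp add: \<phi>0_l \<phi>0_r)
      then show ?thesis using \<phi>_inv[OF h] by simp
    qed
    then have "(\<Sum>k<n. ?F (t k)) = (\<Sum>x\<in>carrier G. ?F x) / of_nat (card H)"
      by (rule sum_t)
    also have "(\<Sum>x\<in>carrier G. ?F x) = (\<Sum>x\<in>carrier G. ?F (x \<otimes> a))"
      by (rule sum_carrier_translate[OF a, symmetric])
    also have "\<dots> = (\<Sum>x\<in>carrier G. if x \<in> H then \<phi>0 (a \<otimes> b) else 0)"
    proof (rule sum.cong[OF refl])
      fix x assume x: "x \<in> carrier G"
      have eq: "a \<otimes> inv (x \<otimes> a) = inv x" "x \<otimes> a \<otimes> b = x \<otimes> (a \<otimes> b)"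
        using x a b by (simp_all add: inv_mult_group m_assoc[symmetric])
      show "?F (x \<otimes> a) = (if x \<in> H then \<phi>0 (a \<otimes> b) else 0)"
      proof (cases "x \<in> H")
        case True
        then show ?thesis
          using eq a b \<phi>_inv[OF True] H_closed(2)[OF True]
          by (simp add: \<phi>0_l) (simp add: \<phi>0_def)
      next
        case False
        then have "inv x \<notin> H"
          using H_closed(2) x by fastforce
        then show ?thesis using False eq by (simp add: \<phi>0_def)
      qed
    qed
    also have "\<dots> = of_nat (card H) * \<phi>0 (a \<otimes> b)"
      using fin subgroup.subset[OF H] by (simp add: sum.If_cases Int_absorb1)
    finally show ?thesis using cardH by simp
  qed
  define \<rho> where "\<rho> g = mat n n (\<lambda>(i, j). \<phi>0 (t i \<otimes> g \<otimes> inv (t j)))" for g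
  have "\<rho> \<one> = 1\<^sub>m n"
    using same t_G \<phi>(1) by (auto simp: \<rho>_def \<phi>0_def intro!: eq_matI)
  moreover have "\<rho> (g \<otimes> h) = \<rho> g * \<rho> h" if g: "g \<in> carrier G" and h: "h \<in> carrier G" for g h
  \<comment> \<open>Entrywise, the product is \<open>conv\<close> with
    \<open>a = t i \<otimes> g\<close> and \<open>b = h \<otimes> inv (t j)\<close>.\<close>
  proof (rule eq_matI)
    fix i j assume "i < dim_row (\<rho> g * \<rho> h)" "j < dim_col (\<rho> g * \<rho> h)"
    then have ij: "i < n" "j < n" by (simp_all add: \<rho>_def)
    then have "(\<rho> g * \<rho> h) $$ (i, j) =
        (\<Sum>k<n. \<phi>0 (t i \<otimes> g \<otimes> inv (t k)) * \<phi>0 (t k \<otimes> h \<otimes> inv (t j)))"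
      by (simp add: \<rho>_def scalar_prod_def atLeast0LessThan)
    also have "\<dots> = (\<Sum>k<n. \<phi>0 (t i \<otimes> g \<otimes> inv (t k)) * \<phi>0 (t k \<otimes> (h \<otimes> inv (t j))))"
      using ij g h t_G by (simp add: m_assoc)
    also have "\<dots> = \<phi>0 (t i \<otimes> g \<otimes> (h \<otimes> inv (t j)))"
      using ij g h t_G by (intro conv) auto
    also have "\<dots> = \<rho> (g \<otimes> h) $$ (i, j)"
      using ij g h t_G by (simp add: \<rho>_def m_assoc)
    finally show "\<rho> (g \<otimes> h) $$ (i, j) = (\<rho> g * \<rho> h) $$ (i, j)" by simp
  qed (simp_all add: \<rho>_def)
  ultimately have "complex_rep G n \<rho>"
    unfolding complex_rep_iff[OF is_group] by (simp add: \<rho>_def)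
  moreover have "induced_character G H \<phi> g = rep_character G n \<rho> g" if g: "g \<in> carrier G" for g
  proof -
    \<comment> \<open>Conjugating by \<open>h\<close> produces the factors \<open>\<phi> h\<close>
      and \<open>\<phi> (inv h)\<close>, which cancel; hence the trace can be averaged over
      \<open>G\<close> by \<open>sum_t\<close>.\<close>
    have inv: "\<phi>0 (h \<otimes> x \<otimes> g \<otimes> inv (h \<otimes> x)) = \<phi>0 (x \<otimes> g \<otimes> inv x)"
      if h: "h \<in> H" and x: "x \<in> carrier G" for h x
    proof -
      have "h \<otimes> x \<otimes> g \<otimes> inv (h \<otimes> x) = h \<otimes> ((x \<otimes> g \<otimes> inv x) \<otimes> inv h)"
        using H_G[OF h] x g by (simp add: inv_mult_group m_assoc)
      then show ?thesis
        using h x g H_closed H_G \<phi>_inv[OF h] by (simp add: \<phi>0_l \<phi>0_r mult.commute)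
    qed
    have "induced_character G H \<phi> g =
        (\<Sum>x\<in>carrier G. \<phi>0 (x \<otimes> g \<otimes> inv x)) / of_nat (card H)"
      unfolding induced_character_extend[OF fin g] \<phi>0_def ..
    also have "\<dots> = (\<Sum>i<n. \<phi>0 (t i \<otimes> g \<otimes> inv (t i)))"
      by (rule sum_t[symmetric]) (rule inv)
    also have "\<dots> = rep_character G n \<rho> g"
      using g by (simp add: rep_character_def \<rho>_def)
    finally show ?thesis .
  qed
  then have "induced_character G H \<phi> = rep_character G n \<rho>"
    by (auto simp: fun_eq_iff induced_character_def rep_character_def)
  ultimately show ?thesis
    by (auto simp: complex_character_def)
qed

end

section \<open>Inner products with inflated characters; here \<open>H\<close> is the normal subgroup
  and \<open>K\<close> the subgroup induced from\<close>

context normal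
begin

text \<open>An inflated function is constant on cosets, so it factors out of each coset sum and only
  the coset sums of \<open>\<sigma>\<close> remain.\<close>

lemma char_inner_inflate:
  assumes "finite (carrier G)"
  shows "char_inner G (\<lambda>g\<in>carrier G. \<chi> (H #> g)) \<sigma> =
    (\<Sum>X\<in>rcosets H. \<chi> X * cnj (\<Sum>x\<in>X. \<sigma> x)) / of_nat (card (carrier G))"
proof -
  have *: "H #> x = X" if "X \<in> rcosets H" "x \<in> X" for x X
    using that repr_independence[OF _ _ is_subgroup] by (auto simp: RCOSETS_def)
  have "(\<Sum>X\<in>rcosets H. \<chi> X * cnj (\<Sum>x\<in>X. \<sigma> x)) =
      (\<Sum>X\<in>rcosets H. \<Sum>x\<in>X. \<chi> (H #> x) * cnj (\<sigma> x))"
    by (intro sum.cong) (auto simp: sum_distrib_left *)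
  also have "\<dots> = (\<Sum>x\<in>carrier G. \<chi> (H #> x) * cnj (\<sigma> x))"
    by (rule sum_over_rcosets[OF is_subgroup assms])
  finally show ?thesis by (simp add: char_inner_def)
qed

text \<open>By normality, conjugation by \<open>x\<close> maps \<open>H #> g\<close> bijectively
  onto the conjugate coset. After swapping the two sums, the inner one is therefore a value of
  \<open>\<Phi>\<close> that depends only on the coset of \<open>x\<close>; each coset contributes
  \<open>card H\<close> times.\<close>

lemma sum_induced_rcoset:
  fixes \<phi> :: "'a \<Rightarrow> complex"
  assumes fin: "finite (carrier G)" and g: "g \<in> carrier G"
    and \<Phi>_def: "\<And>X. \<Phi> X = (\<Sum>x\<in>X. if x \<in> K then \<phi> x else 0)"
  shows "(\<Sum>x\<in>H #> g. induced_character G K \<phi> x) = of_nat (card H) *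
    (\<Sum>Z\<in>rcosets H. \<Phi> (Z <#> (H #> g) <#> inv\<^bsub>G Mod H\<^esub> Z)) / of_nat (card K)"
proof -
  let ?\<phi>0 = "\<lambda>x. if x \<in> K then \<phi> x else 0"
  have conj: "(H #> x) <#> (H #> g) <#> inv\<^bsub>G Mod H\<^esub> (H #> x) = H #> (x \<otimes> g \<otimes> inv x)"
    if x: "x \<in> carrier G" for x
    using x g inv_FactGroup[of "H #> x"] by (simp add: rcos_inv rcos_sum rcosetsI subset FactGroup_def)
  have cancel: "inv x \<otimes> (x \<otimes> y) = y" "x \<otimes> (inv x \<otimes> y) = y"
    if "x \<in> carrier G" "y \<in> carrier G" for x y
    using that by (simp_all add: m_assoc[symmetric])
  have inner: "(\<Sum>y\<in>H #> g. ?\<phi>0 (x \<otimes> y \<otimes> inv x)) = \<Phi> (H #> (x \<otimes> g \<otimes> inv x))"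
    if x: "x \<in> carrier G" for x
    unfolding \<Phi>_def
  proof (rule sum.reindex_bij_witness[of _ "\<lambda>y. inv x \<otimes> y \<otimes> x" "\<lambda>y. x \<otimes> y \<otimes> inv x"])
    fix y assume "y \<in> H #> g"
    then obtain h where h: "h \<in> H" and y: "y = h \<otimes> g" by (auto simp: r_coset_def)
    show "inv x \<otimes> (x \<otimes> y \<otimes> inv x) \<otimes> x = y"
      using x g h y by (simp add: m_assoc cancel)
    have "x \<otimes> y \<otimes> inv x = (x \<otimes> h \<otimes> inv x) \<otimes> (x \<otimes> g \<otimes> inv x)"
      using x g h y by (simp add: m_assoc cancel)
    then show "x \<otimes> y \<otimes> inv x \<in> H #> (x \<otimes> g \<otimes> inv x)"
      using inv_op_closed2[OF x h] by (auto simp: r_coset_def)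
  next
    fix y assume "y \<in> H #> (x \<otimes> g \<otimes> inv x)"
    then obtain h where h: "h \<in> H" and y: "y = h \<otimes> (x \<otimes> g \<otimes> inv x)" by (auto simp: r_coset_def)
    show "x \<otimes> (inv x \<otimes> y \<otimes> x) \<otimes> inv x = y"
      using x g h y by (simp add: m_assoc cancel)
    have "inv x \<otimes> y \<otimes> x = (inv x \<otimes> h \<otimes> x) \<otimes> g"
      using x g h y by (simp add: m_assoc cancel)
    then show "inv x \<otimes> y \<otimes> x \<in> H #> g"
      using inv_op_closed1[OF x h] by (auto simp: r_coset_def)
  qed simp
  \<comment> \<open>\<open>F\<close> is defined through \<open>x\<close>, but \<open>conj\<close>
    rewrites it in terms of \<open>H #> x\<close> alone; this gives the invariance needed to sum
    over cosets.\<close>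
  define F where "F x = \<Phi> (H #> (x \<otimes> g \<otimes> inv x))" for x
  have F: "F x = \<Phi> ((H #> x) <#> (H #> g) <#> inv\<^bsub>G Mod H\<^esub> (H #> x))" if "x \<in> carrier G" for x
    using conj[OF that] by (simp add: F_def)
  define r where "r X = (SOME x. x \<in> X)" for X :: "'a set"
  have r: "r X \<in> X" if "X \<in> rcosets H" for X
    using that rcosets_non_empty[OF that] by (simp add: r_def some_in_eq)
  have r_G: "r X \<in> carrier G" and r_eq: "H #> r X = X" if X: "X \<in> rcosets H" for X
    using r[OF X] X rcosets_carrier[OF is_group X] repr_independence[OF _ _ is_subgroup]
    by (auto simp: RCOSETS_def)
  have "(\<Sum>y\<in>H #> g. induced_character G K \<phi> y) =
      (\<Sum>y\<in>H #> g. (\<Sum>x\<in>carrier G. ?\<phi>0 (x \<otimes> y \<otimes> inv x)) / of_nat (card K))"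
    by (rule sum.cong[OF refl], rule induced_character_extend[OF fin])
       (use g r_coset_subset_G[OF subset] in blast)
  also have "\<dots> = (\<Sum>y\<in>H #> g. \<Sum>x\<in>carrier G. ?\<phi>0 (x \<otimes> y \<otimes> inv x)) / of_nat (card K)"
    by (simp add: sum_divide_distrib)
  also have "(\<Sum>y\<in>H #> g. \<Sum>x\<in>carrier G. ?\<phi>0 (x \<otimes> y \<otimes> inv x)) = (\<Sum>x\<in>carrier G. F x)"
    by (subst sum.swap) (simp add: inner F_def cong: sum.cong)
  also have "\<dots> = of_nat (card H) * (\<Sum>X\<in>rcosets H. F (r X))"
  proof (rule sum_rcosets_invariant[OF is_subgroup fin _ r, symmetric])
    fix h x assume hx: "h \<in> H" "x \<in> carrier G"
    then have "H #> (h \<otimes> x) = H #> x"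
      by (metis coset_join2 coset_mult_assoc is_subgroup mem_carrier subset)
    then show "F (h \<otimes> x) = F x"
      using hx F by simp
  qed
  also have "(\<Sum>X\<in>rcosets H. F (r X)) =
      (\<Sum>Z\<in>rcosets H. \<Phi> (Z <#> (H #> g) <#> inv\<^bsub>G Mod H\<^esub> Z))"
    by (intro sum.cong) (simp_all add: F r_G r_eq)
  finally show ?thesis by simp
qed

text \<open>Substitute \<open>x = h \<otimes> k\<close>: as \<open>k\<close> lies in
  \<open>K\<close>, the product is in \<open>K\<close> exactly when \<open>h\<close> is, and then
  \<open>\<phi> k\<close> splits off.\<close>

lemma sum_linear_character_rcoset:
  assumes K: "subgroup K G" and lin: "linear_character (G\<lparr>carrier := K\<rparr>) \<phi>" and k: "k \<in> K"
  shows "(\<Sum>x\<in>H #> k. if x \<in> K then \<phi> x else 0) = (\<Sum>x\<in>H. if x \<in> K then \<phi> x else 0) * \<phi> k"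
proof -
  have k_G: "k \<in> carrier G" using k K subgroup.subset by blast
  have \<phi>: "\<phi> (h \<otimes> k) = \<phi> h * \<phi> k" if "h \<in> K" for h
    using that k lin linear_character_iff[OF subgroup_imp_group[OF K]] by simp
  have mem: "h \<otimes> k \<in> K \<longleftrightarrow> h \<in> K" if "h \<in> H" for h
    using that k k_G K subgroup.m_closed[OF K] subgroup.m_inv_closed[OF K]
    by (metis inv_solve_right mem_carrier m_closed)
  have "(\<Sum>x\<in>H #> k. if x \<in> K then \<phi> x else 0) =
      (\<Sum>h\<in>H. if h \<otimes> k \<in> K then \<phi> (h \<otimes> k) else 0)"
    by (rule sum.reindex_bij_witness[of _ "\<lambda>h. h \<otimes> k" "\<lambda>x. x \<otimes> inv k"])
       (use k_G in \<open>auto simp: r_coset_def m_assoc\<close>)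
  also have "\<dots> = (\<Sum>x\<in>H. if x \<in> K then \<phi> x else 0) * \<phi> k"
    unfolding sum_distrib_right by (intro sum.cong) (simp_all add: mem \<phi>)
  finally show ?thesis .
qed

text \<open>In the second case the same \<open>\<tau>\<close> and \<open>c\<close> serve every
  \<open>\<chi>\<close>, so a strict inequality between two inner products passes to the
  quotient.\<close>

lemma char_inner_inflate_induced:
  assumes fin: "finite (carrier G)" and K: "subgroup K G"
    and lin: "linear_character (G\<lparr>carrier := K\<rparr>) \<phi>"
  obtains (orthogonal) "\<And>\<chi>. char_inner G (\<lambda>g\<in>carrier G. \<chi> (H #> g)) (induced_character G K \<phi>) = 0"
    | (monomial) \<tau> and c :: real where "monomial_character (G Mod H) \<tau>" "c > 0"
      "\<And>\<chi>. char_inner G (\<lambda>g\<in>carrier G. \<chi> (H #> g)) (induced_character G K \<phi>) =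
        of_real c * char_inner (G Mod H) \<chi> \<tau>"
proof -
  let ?Q = "G Mod H"
  let ?\<pi> = "\<lambda>x. H #> x"
  interpret Q: group ?Q by (rule factorgroup_is_group)
  interpret \<pi>: group_hom G ?Q ?\<pi>
    by unfold_locales (rule r_coset_hom_Mod)
  have carrier_Q: "carrier ?Q = rcosets H" by (simp add: FactGroup_def)
  have mult_Q: "X \<otimes>\<^bsub>?Q\<^esub> Y = X <#> Y" for X Y by (simp add: FactGroup_def)
  have finQ: "finite (carrier ?Q)" using fin by (simp add: carrier_Q RCOSETS_def)
  have \<pi>K: "subgroup (?\<pi> ` K) ?Q" by (rule \<pi>.subgroup_img_is_subgroup[OF K])
  have K_G: "k \<in> carrier G" if "k \<in> K" for k using that K subgroup.subset by blast
  have \<phi>: "\<phi> \<one> = 1" "\<And>h k. \<lbrakk>h \<in> K; k \<in> K\<rbrakk> \<Longrightarrow> \<phi> (h \<otimes> k) = \<phi> h * \<phi> k"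
    using lin linear_character_iff[OF subgroup_imp_group[OF K]] by simp_all
  txt \<open>
    For \<open>c \<noteq> 0\<close>, \<open>\<Phi> / c\<close> is a function on cosets that agrees with \<open>\<phi>\<close> on \<open>K\<close>, so \<open>\<phi>\<close> factors
    through the quotient.
  \<close>
  define \<Phi> where "\<Phi> X = (\<Sum>x\<in>X. if x \<in> K then \<phi> x else 0)" for X
  define c where "c = \<Phi> H"
  have \<Phi>_in: "\<Phi> (?\<pi> k) = c * \<phi> k" if "k \<in> K" for k
    using sum_linear_character_rcoset[OF K lin that] by (simp add: \<Phi>_def c_def)
  \<comment> \<open>A coset containing some \<open>x\<close> in \<open>K\<close> equals
    \<open>H #> x\<close>, so a coset outside the image of \<open>K\<close> misses \<open>K\<close>
    and its sum is empty of nonzero terms.\<close>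
  have \<Phi>_out: "\<Phi> X = 0" if "X \<in> rcosets H" "X \<notin> ?\<pi> ` K" for X
  proof -
    have "x \<notin> K" if "x \<in> X" for x
      using that \<open>X \<in> rcosets H\<close> \<open>X \<notin> ?\<pi> ` K\<close> repr_independence[OF _ _ is_subgroup]
      by (auto simp: RCOSETS_def)
    then show ?thesis by (simp add: \<Phi>_def)
  qed
  have coset_sum: "(\<Sum>x\<in>X. induced_character G K \<phi> x) =
      of_nat (card H) * (\<Sum>Z\<in>rcosets H. \<Phi> (Z <#> X <#> inv\<^bsub>?Q\<^esub> Z)) / of_nat (card K)"
    if "X \<in> rcosets H" for X
    using that sum_induced_rcoset[OF fin _ \<Phi>_def] by (auto simp: RCOSETS_def)
  have conj_Q: "Z <#> X <#> inv\<^bsub>?Q\<^esub> Z \<in> rcosets H" if "X \<in> rcosets H" "Z \<in> rcosets H" for X Z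
    using that Q.m_closed Q.inv_closed by (simp add: FactGroup_def)
  show thesis
  proof (cases "c = 0")
    case True
    have "\<Phi> X = 0" if "X \<in> rcosets H" for X
      using \<Phi>_out[OF that] \<Phi>_in True by fastforce
    then have "(\<Sum>x\<in>X. induced_character G K \<phi> x) = 0" if "X \<in> rcosets H" for X
      using that by (simp add: coset_sum conj_Q)
    then show thesis
      by (intro orthogonal) (simp add: char_inner_inflate[OF fin])
  next
    case False
    define \<psi> where "\<psi> = (\<lambda>X\<in>?\<pi> ` K. \<Phi> X / c)"
    have \<psi>: "\<psi> (?\<pi> k) = \<phi> k" if "k \<in> K" for k
      using that False by (simp add: \<psi>_def \<Phi>_in)
    \<comment> \<open>Elements of \<open>K\<close> in \<open>H\<close> have the same coset as
      \<open>\<one>\<close>, and \<open>\<psi>\<close> sees only the coset.\<close>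
    have \<phi>_triv: "\<phi> k = 1" if "k \<in> K" "k \<in> H" for k
      using that \<psi>[of k] \<psi>[of \<one>] \<phi>(1) subgroup.one_closed[OF K]
      by (metis coset_join2 is_subgroup mem_carrier one_closed subgroup.one_closed)
    \<comment> \<open>Every term of \<open>c\<close> is now 1, so the complex number
      \<open>c\<close> is a positive integer; this is what makes the final factor real and
      positive.\<close>
    have c_eq: "c = of_nat (card (H \<inter> K))"
      using fin finite_subset[OF subset fin] \<phi>_triv by (simp add: c_def \<Phi>_def sum.If_cases)
    have lin\<psi>: "linear_character (?Q\<lparr>carrier := ?\<pi> ` K\<rparr>) \<psi>"
    proof -
      have one: "\<psi> H = 1"
        using \<psi>[of \<one>] \<phi>(1) subgroup.one_closed[OF K] by (simp add: coset_mult_one subset)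
      have "\<psi> (?\<pi> h <#> ?\<pi> k) = \<psi> (?\<pi> h) * \<psi> (?\<pi> k)" if "h \<in> K" "k \<in> K" for h k
        using that \<psi>[of h] \<psi>[of k] \<psi>[of "h \<otimes> k"] \<phi>(2)[of h k] rcos_sum[of h k]
          K_G[of h] K_G[of k] subgroup.m_closed[OF K, of h k] by metis
      then show ?thesis
        unfolding linear_character_iff[OF Q.subgroup_imp_group[OF \<pi>K]]
        using one by (auto simp: FactGroup_def) (simp add: \<psi>_def)
    qed
    define \<tau> where "\<tau> = induced_character ?Q (?\<pi> ` K) \<psi>"
    have mon: "monomial_character ?Q \<tau>"
      unfolding monomial_character_def \<tau>_def
      using Q.complex_character_induced[OF finQ \<pi>K lin\<psi>] \<pi>K lin\<psi> by blast
    \<comment> \<open>The factors are \<open>card H\<close> and \<open>1 / card K\<close> from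
      \<open>coset_sum\<close>, the value of \<open>c\<close>, and the order of the image of
      \<open>K\<close>, by which \<open>\<tau>\<close> is divided.\<close>
    define d where "d = real (card H) * real (card (H \<inter> K)) * real (card (?\<pi> ` K)) / real (card K)"
    have finK: "finite K" using fin K finite_subset subgroup.subset by blast
    have pos: "card (carrier G) > 0" "card (rcosets H) > 0" "card (?\<pi> ` K) > 0" "card K > 0"
      "card H > 0" "card (H \<inter> K) > 0"
      using fin finQ finK finite_subset[OF subset fin] subgroup.one_closed[OF K]
        Q.one_closed subgroup.one_closed[OF is_subgroup] one_closed
      unfolding card_gt_0_iff carrier_Q by blast+
    have sum_\<tau>: "(\<Sum>x\<in>X. induced_character G K \<phi> x) = of_real d * \<tau> X" if X: "X \<in> rcosets H" for X
    proof -
      have "\<Phi> Y = c * (if Y \<in> ?\<pi> ` K then \<psi> Y else 0)" if "Y \<in> rcosets H" for Y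
        using \<Phi>_out[OF that] \<Phi>_in \<psi> by auto
      then have "(\<Sum>Z\<in>rcosets H. \<Phi> (Z <#> X <#> inv\<^bsub>?Q\<^esub> Z)) =
          c * (\<Sum>Z\<in>rcosets H. if Z <#> X <#> inv\<^bsub>?Q\<^esub> Z \<in> ?\<pi> ` K then \<psi> (Z <#> X <#> inv\<^bsub>?Q\<^esub> Z) else 0)"
        using X conj_Q by (simp add: sum_distrib_left cong: sum.cong)
      also have "\<dots> = c * (of_nat (card (?\<pi> ` K)) * \<tau> X)"
        using Q.induced_character_extend[OF finQ, of X "?\<pi> ` K" \<psi>] X pos
        by (simp add: \<tau>_def carrier_Q mult_Q cong: if_cong)
      finally show ?thesis
        using coset_sum[OF X] by (simp add: d_def c_eq)
    qed
    \<comment> \<open>The index and the order of \<open>G\<close> convert between the normalisations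
      of the two inner products. Counting gives \<open>d = card H\<close> and \<open>e = 1\<close>;
      the case \<open>monomial\<close> asks for positivity.\<close>
    define e where "e = d * real (card (rcosets H)) / real (card (carrier G))"
    have "e > 0" using pos by (simp add: e_def d_def)
    moreover have "char_inner G (\<lambda>g\<in>carrier G. \<chi> (H #> g)) (induced_character G K \<phi>) =
        of_real e * char_inner ?Q \<chi> \<tau>" for \<chi>
    proof -
      have "(\<Sum>X\<in>rcosets H. \<chi> X * cnj (\<Sum>x\<in>X. induced_character G K \<phi> x)) =
          of_real d * (\<Sum>X\<in>rcosets H. \<chi> X * cnj (\<tau> X))"
        unfolding sum_distrib_left by (intro sum.cong) (simp_all add: sum_\<tau>)
      then show ?thesis
        unfolding char_inner_inflate[OF fin]
        unfolding char_inner_def carrier_Q e_def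
        using pos by simp
    qed
    ultimately show thesis using mon by (intro monomial) auto
  qed
qed

end

theorem theorem2p9:
  fixes G (structure)
  assumes "group G"
    and "finite (carrier G)"
    and "weak_almost_monomial G"
    and "N \<lhd> G"
  shows "weak_almost_monomial (G Mod N)"
  unfolding weak_almost_monomial_def
proof (intro allI impI)
  interpret N: normal N G by fact
  fix \<chi> \<psi>
  assume \<chi>: "irreducible_character (G Mod N) \<chi>" and \<psi>: "irreducible_character (G Mod N) \<psi>"
    and "\<chi> \<noteq> \<psi>"
  let ?infl = "\<lambda>\<chi>. \<lambda>g\<in>carrier G. \<chi> (N #> g)"
  have onto: "(\<lambda>g. N #> g) ` carrier G = carrier (G Mod N)"
    by (auto simp: FactGroup_def RCOSETS_def)
  \<comment> \<open>Both characters take the same default value off the carrier, so they must differ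
    at an actual coset; this keeps their inflations distinct.\<close>
  have "\<chi> X = undefined" "\<psi> X = undefined" if "X \<notin> carrier (G Mod N)" for X
    using \<chi> \<psi> that by (auto simp: irreducible_character_def rep_character_def)
  then obtain X where "X \<in> carrier (G Mod N)" "\<chi> X \<noteq> \<psi> X"
    using \<open>\<chi> \<noteq> \<psi>\<close> by (metis ext)
  then obtain g where "g \<in> carrier G" "\<chi> (N #> g) \<noteq> \<psi> (N #> g)"
    using onto by (metis (no_types, lifting) imageE)
  then have "?infl \<chi> \<noteq> ?infl \<psi>" by (metis restrict_apply')
  moreover have "irreducible_character G (?infl \<chi>)" "irreducible_character G (?infl \<psi>)"
    using irreducible_character_comp_hom[OF N.r_coset_hom_Mod onto] \<chi> \<psi> by blast+
  ultimately obtain \<sigma> where "monomial_character G \<sigma>"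
    and less: "char_inner G (?infl \<psi>) \<sigma> < char_inner G (?infl \<chi>) \<sigma>"
    using assms(3) unfolding weak_almost_monomial_def by blast
  then obtain K \<phi> where K: "subgroup K G" "linear_character (G\<lparr>carrier := K\<rparr>) \<phi>"
    and \<sigma>: "\<sigma> = induced_character G K \<phi>"
    by (auto simp: monomial_character_def)
  show "\<exists>\<sigma>. monomial_character (G Mod N) \<sigma> \<and>
      char_inner (G Mod N) \<psi> \<sigma> < char_inner (G Mod N) \<chi> \<sigma>"
    using assms(2) K
  proof (cases rule: N.char_inner_inflate_induced)
    case orthogonal
    \<comment> \<open>Both inner products with \<open>\<sigma>\<close> would be 0, contradicting the
      strict inequality.\<close>
    then show ?thesis using less by (simp add: \<sigma>)
  next
    case (monomial \<tau> c)
    have "char_inner (G Mod N) \<psi> \<tau> < char_inner (G Mod N) \<chi> \<tau>"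
      \<comment> \<open>The order on \<open>complex\<close> compares real parts and equates
        imaginary parts; a positive real factor cancels from both conditions.\<close>
      using less monomial(2) unfolding \<sigma> monomial(3) by (simp add: less_complex_def)
    then show ?thesis using monomial(1) by blast
  qed
qed

end
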